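(* Let $(X,\leq)$ be a linearly ordered set and $(Y,d)$ a compact metric space. Then, for every $r>0$, the compact space $BV^{\prec}_r(X,Y)$ of all functions $f:X\to Y$ of variation not greater than $r$ is sequentially compact in the pointwise topology.
   Context: For a linearly ordered set $(X,\leq)$ and a metric space $(Y,d)$, $BV^{\prec}_r(X,Y)$ denotes the set of all bounded functions $f:X\to Y$ such that $\sum_{i=1}^{n-1}d(f(x_i),f(x_{i+1}))\leq r$ for every choice of $x_1<x_2<\dots<x_n$ in $X$. It carries the pointwise topology inherited from $Y^X$. No topology on $X$ is used and $f$ need not be continuous. Sequentially compact: every sequence has a subsequence converging (pointwise) to an element of the space. *)

theory Defs
  imports "HOL-Analysis.Analysis" "HOL-Library.FuncSet"
begin

text \<open>
  A function \<open>X \<rightarrow> Y\<close> is an element of \<open>X \<rightarrow>\<^sub>E Y\<close>, i.e. a function on the whole type with the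
  fixed value \<open>undefined\<close> off \<open>X\<close>. The library's topology on a function type is the product
  topology, so the subspace topology on \<open>X \<rightarrow>\<^sub>E Y\<close> is that of \<open>Y\<^sup>X\<close>, the pointwise topology on \<open>X\<close>;
  the order on \<open>X\<close> plays no part in it.
\<close>

definition BV ::
  "real \<Rightarrow> 'a::linorder set \<Rightarrow> 'b::metric_space set \<Rightarrow> ('a \<Rightarrow> 'b) set"
where
  "BV r X Y = {f \<in> X \<rightarrow>\<^sub>E Y. bounded (f ` X) \<and>
     (\<forall>n::nat. \<forall>x::nat \<Rightarrow> 'a.
        x ` {1..n} \<subseteq> X \<and> strict_mono_on {1..n} x \<longrightarrow>
        (\<Sum>i = 1..n - 1. dist (f (x i)) (f (x (i + 1)))) \<le> r)}"

end

theory Submission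
  imports Defs
begin

text \<open>
  Compactness is Tychonoff's theorem, as the variation bound is a closed condition.
  For sequential compactness, let \<open>v\<^sub>n\<close> be the variation function of \<open>f\<^sub>n\<close>. All the \<open>v\<^sub>n\<close>, and
  with them all the \<open>f\<^sub>n\<close>, factor through the monotone map \<open>h = \<Sum>n. 2\<^sup>-\<^sup>n v\<^sub>n\<close> from \<open>X\<close> into the
  real line, so Helly's selection argument can be run on the separable set \<open>h ` X\<close>: after
  passing to a subsequence, the monotone extensions \<open>w\<^sub>n\<close> of the \<open>v\<^sub>n\<close> to the line converge at
  the rationals and the \<open>f\<^sub>n\<close> converge over a countable dense subset of \<open>h ` X\<close>. Where the monotone
  limit \<open>V\<close> of the \<open>w\<^sub>n\<close> is continuous this forces \<open>f\<^sub>n\<close> to be Cauchy, and the countably many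
  discontinuities of \<open>V\<close> are handled by one further subsequence.
\<close>

section \<open>Pointwise convergence and compactness in function spaces\<close>

lemma tendsto_fun_iff:
  fixes f :: "'c \<Rightarrow> 'a \<Rightarrow> 'b::topological_space"
  shows "(f \<longlongrightarrow> l) F \<longleftrightarrow> (\<forall>x. ((\<lambda>n. f n x) \<longlongrightarrow> l x) F)"
  using limitin_componentwise[of "\<lambda>_. euclidean" UNIV f l F]
  by (simp add: euclidean_product_topology)

lemma compact_PiE:
  fixes S :: "'a \<Rightarrow> 'b::topological_space set"
  assumes "\<And>i. compact (S i)"
  shows "compact (PiE UNIV S)"
  using compactin_PiE[of "\<lambda>_. euclidean" UNIV S] assms
  by (simp add: euclidean_product_topology)

text \<open>Enumerating \<open>C\<close> turns the \<open>f n\<close> into points of a countable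
  power of \<open>K\<close>, which is compact by Tychonoff and, being first countable, sequentially
  compact. This replaces a diagonal argument.\<close>

lemma convergent_subseq_on_countable:
  fixes f :: "nat \<Rightarrow> 'a \<Rightarrow> 'b::metric_space"
  assumes K: "compact K" and C: "countable C" and f: "\<And>n c. c \<in> C \<Longrightarrow> f n c \<in> K"
  obtains s :: "nat \<Rightarrow> nat" where "strict_mono s" "\<And>c. c \<in> C \<Longrightarrow> convergent (\<lambda>n. f (s n) c)"
proof (cases "C = {}")
  case True
  then show ?thesis using that[of id] by (simp add: strict_mono_def)
next
  case False
  define F where "F n k = f n (from_nat_into C k)" for n k
  have "seq_compact (PiE UNIV (\<lambda>_::nat. K))"
    by (intro compact_imp_seq_compact compact_PiE K)
  moreover have "F n \<in> PiE UNIV (\<lambda>_. K)" for n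
    unfolding F_def using f from_nat_into[OF False] by auto
  ultimately obtain l s where s: "strict_mono s" and l: "(F \<circ> s) \<longlonglongrightarrow> l"
    unfolding seq_compact_def by metis
  have "convergent (\<lambda>n. f (s n) c)" if c: "c \<in> C" for c
  proof -
    have "(\<lambda>n. F (s n) (to_nat_on C c)) \<longlonglongrightarrow> l (to_nat_on C c)"
      using l by (simp add: tendsto_fun_iff)
    then show ?thesis
      unfolding F_def convergent_def using C c by auto
  qed
  with s show ?thesis using that by blast
qed

section \<open>The variation function\<close>

text \<open>The chains end exactly at \<open>a\<close>, so that appending a point \<open>b > a\<close> adds exactly the
  term \<open>dist (f a) (f b)\<close>.\<close>

definition chain_sums :: "('a::linorder \<Rightarrow> 'b::metric_space) \<Rightarrow> 'a set \<Rightarrow> 'a \<Rightarrow> real set" where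
  "chain_sums f X a = {\<Sum>i = 1..n - 1. dist (f (x i)) (f (x (i + 1))) | n x.
     1 \<le> n \<and> x n = a \<and> x ` {1..n} \<subseteq> X \<and> strict_mono_on {1..n::nat} x}"

text \<open>For \<open>a\<close> in \<open>X\<close> this is the variation of \<open>f\<close> on
  the points of \<open>X\<close> up to \<open>a\<close>, since adding \<open>a\<close> to a chain
  below it never lowers the sum.\<close>

definition variation :: "('a::linorder \<Rightarrow> 'b::metric_space) \<Rightarrow> 'a set \<Rightarrow> 'a \<Rightarrow> real" where
  "variation f X a = Sup (chain_sums f X a)"

lemma chain_sums_le:
  assumes "f \<in> BV r X Y" "s \<in> chain_sums f X a"
  shows "s \<le> r"
  using assms unfolding chain_sums_def BV_def by auto

lemma zero_in_chain_sums:
  assumes "a \<in> X"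
  shows "0 \<in> chain_sums f X a"
  unfolding chain_sums_def using assms
  by (intro CollectI exI[of _ "1::nat"] exI[of _ "\<lambda>_. a"]) (auto simp: strict_mono_on_def)

lemma chain_sums_extend:
  assumes "s \<in> chain_sums f X a" "a < b" "b \<in> X"
  shows "s + dist (f a) (f b) \<in> chain_sums f X b"
proof -
  obtain n :: nat and x where n: "1 \<le> n" and xn: "x n = a" and xX: "x ` {1..n} \<subseteq> X"
    and x: "strict_mono_on {1..n} x"
    and s: "s = (\<Sum>i = 1..n - 1. dist (f (x i)) (f (x (i + 1))))"
    using assms(1) unfolding chain_sums_def by blast
  define y where "y = x(Suc n := b)"
  have le: "x i \<le> a" if "i \<in> {1..n}" for i
    using strict_mono_on_leD[OF x that, of n] that n xn by auto
  have "y ` {1..Suc n} \<subseteq> X"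
    using xX assms(3) by (auto simp: y_def)
  moreover have "strict_mono_on {1..Suc n} y"
  proof (rule strict_mono_onI)
    fix i j assume ij: "i \<in> {1..Suc n}" "j \<in> {1..Suc n}" "i < j"
    show "y i < y j"
    proof (cases "j = Suc n")
      case True
      then show ?thesis using ij le[of i] assms(2) by (auto simp: y_def)
    next
      case False
      then show ?thesis using ij strict_mono_onD[OF x, of i j] by (auto simp: y_def)
    qed
  qed
  moreover have "(\<Sum>i = 1..Suc n - 1. dist (f (y i)) (f (y (i + 1)))) = s + dist (f a) (f b)"
  proof -
    obtain m where m: "n = Suc m" using n by (cases n) auto
    have "(\<Sum>i = 1..m. dist (f (y i)) (f (y (i + 1)))) = s"
      unfolding s m by (intro sum.cong) (auto simp: y_def m)
    moreover have "y (Suc m) = a" "y (Suc (Suc m)) = b"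
      using xn by (auto simp: y_def m)
    ultimately show ?thesis by (simp add: m)
  qed
  ultimately show ?thesis
    unfolding chain_sums_def
    by (intro CollectI exI[of _ "Suc n"] exI[of _ y]) (auto simp: y_def)
qed

lemma bdd_above_chain_sums: "f \<in> BV r X Y \<Longrightarrow> bdd_above (chain_sums f X a)"
  using chain_sums_le by (metis bdd_aboveI)

lemma variation_bounds:
  assumes "f \<in> BV r X Y" "a \<in> X"
  shows "variation f X a \<in> {0..r}"
proof -
  have "0 \<le> variation f X a"
    unfolding variation_def
    by (intro cSup_upper zero_in_chain_sums assms bdd_above_chain_sums[OF assms(1)])
  moreover have "variation f X a \<le> r"
    unfolding variation_def
    using zero_in_chain_sums[OF assms(2)] chain_sums_le[OF assms(1)] by (intro cSup_least) auto
  ultimately show ?thesis by simp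
qed

text \<open>Every chain ending at \<open>a\<close> can be prolonged by \<open>b\<close>. The
  inequality yields both that the variation is monotone and that its increments control
  \<open>f\<close>.\<close>

lemma variation_add_dist_le:
  assumes f: "f \<in> BV r X Y" and "a \<in> X" "b \<in> X" "a < b"
  shows "variation f X a + dist (f a) (f b) \<le> variation f X b"
proof -
  have "variation f X a \<le> variation f X b - dist (f a) (f b)"
    unfolding variation_def[of f X a]
  proof (rule cSup_least)
    show "chain_sums f X a \<noteq> {}" using zero_in_chain_sums[OF \<open>a \<in> X\<close>] by auto
    fix s assume "s \<in> chain_sums f X a"
    then have "s + dist (f a) (f b) \<le> variation f X b"
      unfolding variation_def using assms
      by (intro cSup_upper chain_sums_extend bdd_above_chain_sums[OF f])
    then show "s \<le> variation f X b - dist (f a) (f b)" by simp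
  qed
  then show ?thesis by simp
qed

section \<open>Helly's selection argument\<close>

lemma Helly_selection_variation:
  fixes f :: "nat \<Rightarrow> 'a::linorder \<Rightarrow> 'b::metric_space" and v :: "nat \<Rightarrow> 'a \<Rightarrow> real"
  assumes Y: "compact Y" and fY: "\<And>n x. x \<in> X \<Longrightarrow> f n x \<in> Y"
    and v: "\<And>n x. x \<in> X \<Longrightarrow> v n x \<in> {0..r}"
    and vf: "\<And>n x y. x \<in> X \<Longrightarrow> y \<in> X \<Longrightarrow> x < y \<Longrightarrow> v n x + dist (f n x) (f n y) \<le> v n y"
  obtains s :: "nat \<Rightarrow> nat" where "strict_mono s" "\<And>x. x \<in> X \<Longrightarrow> convergent (\<lambda>n. f (s n) x)"
proof (cases "X = {}")
  case True
  then show ?thesis using that[of id] by (simp add: strict_mono_def)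
next
  case False
  then have r: "0 \<le> r" using v by fastforce
  have v_mono: "v n x \<le> v n y" if "x \<in> X" "y \<in> X" "x \<le> y" for n x y
  proof (cases "x = y")
    case False
    then have "v n x + dist (f n x) (f n y) \<le> v n y" using vf that by simp
    then show ?thesis using zero_le_dist[of "f n x" "f n y"] by linarith
  qed simp
  have dist_le: "dist (f n x) (f n y) \<le> \<bar>v n x - v n y\<bar>" if "x \<in> X" "y \<in> X" for n x y
  proof (cases x y rule: linorder_cases)
    case less
    then show ?thesis using vf[OF that less, of n] by linarith
  next
    case greater
    then show ?thesis using vf[OF that(2,1) greater, of n] by (simp add: dist_commute)
  qed simp

  \<comment> \<open>The geometric weights make the series converge, and being positive they keep
    every \<open>v n\<close> visible in \<open>h\<close>.\<close>
  define h where "h x = (\<Sum>n. (1/2)^n * v n x)" for x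
  have summ: "summable (\<lambda>n. (1/2)^n * v n x)" if "x \<in> X" for x
  proof (rule summable_comparison_test')
    show "summable (\<lambda>n. (1/2)^n * r)" by (intro summable_mult2 summable_geometric) auto
    show "norm ((1/2)^n * v n x) \<le> (1/2)^n * r" for n
      using v[OF that, of n] by (auto simp: abs_mult intro!: mult_left_mono)
  qed
  have h_mono: "h x \<le> h y" if "x \<in> X" "y \<in> X" "x \<le> y" for x y
    unfolding h_def using that by (intro suminf_le summ mult_left_mono v_mono) auto
  \<comment> \<open>A vanishing series of nonnegative terms has only zero terms, so points that
    \<open>h\<close> identifies are identified by every \<open>v n\<close>.\<close>
  have h_eq: "v n x = v n y" if xy: "x \<in> X" "y \<in> X" "x \<le> y" and "h x = h y" for n x y
  proof -
    have "(\<Sum>n. (1/2)^n * v n y - (1/2)^n * v n x) = 0"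
      using suminf_diff[OF summ[OF xy(2)] summ[OF xy(1)]] that by (simp add: h_def)
    moreover have "summable (\<lambda>n. (1/2)^n * v n y - (1/2)^n * v n x)"
      by (intro summable_diff summ xy)
    ultimately have "(1/2)^n * v n y - (1/2)^n * v n x = 0"
      using v_mono[OF xy] by (subst (asm) suminf_eq_zero_iff) (auto intro!: mult_left_mono)
    then show ?thesis by simp
  qed
  have v_le: "v n x \<le> v n y" if "x \<in> X" "y \<in> X" "h x \<le> h y" for n x y
  proof (cases "x \<le> y")
    case True then show ?thesis using v_mono that by blast
  next
    case False
    then show ?thesis using h_eq[of y x n] h_mono[of y x] that by auto
  qed

  \<comment> \<open>Inserting 0 gives a value to arguments below all values of \<open>h\<close>; it
    leaves the other suprema unchanged, as \<open>v n\<close> is nonnegative on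
    \<open>X\<close>.\<close>
  define w where "w n t = Sup (insert 0 (v n ` {x \<in> X. h x \<le> t}))" for n t
  have bdd: "bdd_above (insert 0 (v n ` {x \<in> X. h x \<le> t}))" for n t
    using v r by (intro bdd_aboveI[of _ r]) auto
  have w_mono: "w n t \<le> w n u" if "t \<le> u" for n t u
    unfolding w_def using that by (intro cSup_subset_mono bdd) auto
  have w_bounds: "w n t \<in> {0..r}" for n t
  proof -
    have "0 \<le> w n t" unfolding w_def by (intro cSup_upper bdd) auto
    moreover have "w n t \<le> r" unfolding w_def using v r by (intro cSup_least) auto
    ultimately show ?thesis by simp
  qed
  have w_h: "w n (h x) = v n x" if "x \<in> X" for n x
    unfolding w_def using v[OF that] v_le that by (intro cSup_eq_maximum) auto

  \<comment> \<open>Separability comes from the real line; \<open>E\<close> then collects preimages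
    in \<open>X\<close> of the dense values.\<close>
  obtain D where D: "countable D" "D \<subseteq> h ` X" "h ` X \<subseteq> closure D"
    using separable by blast
  then obtain E where E: "countable E" "E \<subseteq> X" "D = h ` E"
    by (meson countable_subset_image)
  obtain s1 :: "nat \<Rightarrow> nat" where s1: "strict_mono s1"
    and w_conv: "\<And>q. q \<in> \<rat> \<Longrightarrow> convergent (\<lambda>n. w (s1 n) q)"
    using convergent_subseq_on_countable[of "{0..r}" "\<rat>" w] w_bounds countable_rat by auto
  obtain s2 :: "nat \<Rightarrow> nat" where s2: "strict_mono s2"
    and f_conv: "\<And>e. e \<in> E \<Longrightarrow> convergent (\<lambda>n. f (s1 (s2 n)) e)"
    using convergent_subseq_on_countable[of Y E "\<lambda>n. f (s1 n)"] Y E fY by blast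
  define k where "k n = s1 (s2 n)" for n
  have k: "strict_mono k" using s1 s2 by (auto simp: strict_mono_def k_def)
  define L where "L q = lim (\<lambda>n. w (k n) q)" for q
  have L: "(\<lambda>n. w (k n) q) \<longlonglongrightarrow> L q" if "q \<in> \<rat>" for q
    using convergent_subseq_convergent[OF w_conv[OF that] s2]
    by (simp add: L_def k_def o_def convergent_LIMSEQ_iff)
  have L_mono: "L p \<le> L q" if "p \<in> \<rat>" "q \<in> \<rat>" "p \<le> q" for p q
    using L that w_mono by (meson LIMSEQ_le)
  have L_le: "L q \<le> r" if "q \<in> \<rat>" for q
    using L[OF that] w_bounds by (intro LIMSEQ_le_const2) auto
  \<comment> \<open>\<open>V\<close> extends the limits at the rationals to a monotone function on
    the line, which has only countably many discontinuities.\<close>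
  define V where "V t = Sup (L ` {q \<in> \<rat>. q \<le> t})" for t
  have ne: "L ` {q \<in> \<rat>. q \<le> t} \<noteq> {}" for t :: real
    using Rats_dense_in_real[of "t - 1" t] by fastforce
  have bddL: "bdd_above (L ` {q \<in> \<rat>. q \<le> t})" for t
    using L_le by (intro bdd_aboveI[of _ r]) auto
  have V_mono: "mono V"
    unfolding V_def by (intro monoI cSup_subset_mono ne bddL) auto
  have V_rat: "V q = L q" if "q \<in> \<rat>" for q
    unfolding V_def using that L_mono by (intro cSup_eq_maximum) auto

  have conv: "convergent (\<lambda>n. f (k n) x)" if x: "x \<in> X" and cont: "isCont V (h x)" for x
  proof -
    have "Cauchy (\<lambda>n. f (k n) x)"
    proof (rule metric_CauchyI)
      fix \<epsilon> :: real assume "\<epsilon> > 0"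
      \<comment> \<open>The errors below add up to less than \<open>5 * \<eta>\<close>, so a ninth
        of \<open>\<epsilon>\<close> leaves room.\<close>
      define \<eta> where "\<eta> = \<epsilon> / 9"
      have \<eta>: "\<eta> > 0" "9 * \<eta> = \<epsilon>" using \<open>\<epsilon> > 0\<close> by (auto simp: \<eta>_def)
      obtain \<delta> where \<delta>: "\<delta> > 0" "\<And>u. dist u (h x) < \<delta> \<Longrightarrow> dist (V u) (V (h x)) < \<eta>"
        using cont \<eta> unfolding continuous_at_eps_delta by blast
      obtain p where p: "p \<in> \<rat>" "h x - \<delta> < p" "p < h x"
        using Rats_dense_in_real[of "h x - \<delta>" "h x"] \<delta> by auto
      obtain q where q: "q \<in> \<rat>" "h x < q" "q < h x + \<delta>"
        using Rats_dense_in_real[of "h x" "h x + \<delta>"] \<delta> by auto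
      have "dist (V p) (V (h x)) < \<eta>" "dist (V q) (V (h x)) < \<eta>"
        using p q by (intro \<delta>(2); simp add: dist_real_def)+
      then have "L q - L p < 2 * \<eta>"
        using p q by (auto simp: V_rat dist_real_def)
      then have "eventually (\<lambda>n. w (k n) q - w (k n) p < 2 * \<eta>) sequentially"
        by (rule order_tendstoD(2)[OF tendsto_diff[OF L[OF q(1)] L[OF p(1)]]])
      then obtain N1 where N1: "\<And>n. n \<ge> N1 \<Longrightarrow> w (k n) q - w (k n) p < 2 * \<eta>"
        unfolding eventually_sequentially by auto
      have "h x \<in> closure (h ` E)" using D E x by auto
      then obtain z where "z \<in> h ` E" "dist z (h x) < min (h x - p) (q - h x)"
        using p q closure_approachableD[of "h x" "h ` E" "min (h x - p) (q - h x)"]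
        by (metis diff_gt_0_iff_gt dist_commute min_less_iff_conj)
      then obtain e where e: "e \<in> E" "dist (h e) (h x) < min (h x - p) (q - h x)"
        by blast
      then have eX: "e \<in> X" and pe: "p \<le> h e" and eq: "h e \<le> q"
        using E by (auto simp: dist_real_def)
      \<comment> \<open>Both \<open>v (k n) x\<close> and \<open>v (k n) e\<close> are trapped
        between \<open>w (k n) p\<close> and \<open>w (k n) q\<close>, because \<open>h x\<close>
        and \<open>h e\<close> lie between \<open>p\<close> and \<open>q\<close>.\<close>
      have near: "dist (f (k n) x) (f (k n) e) < 2 * \<eta>" if "n \<ge> N1" for n
      proof -
        have "w (k n) p \<le> v (k n) x" "v (k n) x \<le> w (k n) q"
             "w (k n) p \<le> v (k n) e" "v (k n) e \<le> w (k n) q"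
          using w_mono p q pe eq x eX by (auto simp flip: w_h)
        then show ?thesis
          using dist_le[OF x eX, of "k n"] N1[OF that] by linarith
      qed
      have "Cauchy (\<lambda>n. f (k n) e)"
        using f_conv[OF e(1)] by (simp add: k_def convergent_Cauchy)
      then obtain N2 where N2: "\<And>m n. m \<ge> N2 \<Longrightarrow> n \<ge> N2 \<Longrightarrow> dist (f (k m) e) (f (k n) e) < \<eta>"
        using \<eta> unfolding Cauchy_def by blast
      show "\<exists>M. \<forall>m\<ge>M. \<forall>n\<ge>M. dist (f (k m) x) (f (k n) x) < \<epsilon>"
      proof (intro exI[of _ "max N1 N2"] allI impI)
        fix m n assume "max N1 N2 \<le> m" "max N1 N2 \<le> n"
        then have "dist (f (k m) x) (f (k m) e) < 2 * \<eta>" "dist (f (k n) x) (f (k n) e) < 2 * \<eta>"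
          "dist (f (k m) e) (f (k n) e) < \<eta>"
          using near N2 by auto
        moreover have "dist (f (k m) x) (f (k n) x) \<le>
            dist (f (k m) x) (f (k m) e) + dist (f (k m) e) (f (k n) e) + dist (f (k n) x) (f (k n) e)"
          using dist_triangle[of "f (k m) x" "f (k n) x" "f (k m) e"]
            dist_triangle[of "f (k m) e" "f (k n) x" "f (k n) e"]
          by (simp add: dist_commute)
        ultimately show "dist (f (k m) x) (f (k n) x) < \<epsilon>" using \<eta> by linarith
      qed
    qed
    then show ?thesis
      using compact_imp_complete[OF Y] fY[OF x] unfolding complete_def convergent_def by metis
  qed

  \<comment> \<open>What remains are the points of \<open>X\<close> over discontinuities of
    \<open>V\<close>; \<open>E'\<close> represents each such value of \<open>h\<close>.\<close>
  have "countable ({t. \<not> isCont V t} \<inter> h ` X)"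
    using mono_ctble_discont[OF V_mono] by blast
  then obtain E' where E': "countable E'" "E' \<subseteq> X" "{t. \<not> isCont V t} \<inter> h ` X = h ` E'"
    by (metis Int_lower2 countable_subset_image)
  obtain s3 :: "nat \<Rightarrow> nat" where s3: "strict_mono s3"
    and f_conv': "\<And>e. e \<in> E' \<Longrightarrow> convergent (\<lambda>n. f (k (s3 n)) e)"
    using convergent_subseq_on_countable[of Y E' "\<lambda>n. f (k n)"] Y E' fY by blast
  show ?thesis
  proof (rule that[of "\<lambda>n. k (s3 n)"])
    show "strict_mono (\<lambda>n. k (s3 n))" using k s3 by (auto simp: strict_mono_def)
    fix x assume x: "x \<in> X"
    show "convergent (\<lambda>n. f (k (s3 n)) x)"
    proof (cases "isCont V (h x)")
      case True
      then show ?thesis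
        using convergent_subseq_convergent[OF conv[OF x True] s3] by (simp add: o_def)
    next
      case False
      then obtain e where e: "e \<in> E'" "h e = h x"
        using E'(3) x by (metis (mono_tags, lifting) Int_iff image_iff mem_Collect_eq)
      moreover have "e \<in> X" using e E' by blast
      \<comment> \<open>Equal values of \<open>h\<close> force equal values of every
        \<open>v n\<close>, hence of every \<open>f n\<close>, so convergence at \<open>e\<close>
        carries over to \<open>x\<close>.\<close>
      ultimately have "v n e = v n x" for n
        using x by (intro antisym v_le) auto
      then have "f n e = f n x" for n
        using dist_le[OF \<open>e \<in> X\<close> x, of n] by simp
      then show ?thesis using f_conv'[OF e(1)] by simp
    qed
  qed
qed

section \<open>Compactness and the conclusion\<close>

text \<open>Each variation inequality involves finitely many coordinates, hence is closed in the
  product topology; compactness of \<open>Y\<close> supplies boundedness.\<close>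

lemma BV_eq_Int_closed:
  fixes X :: "'a::linorder set" and Y :: "'b::metric_space set"
  assumes "compact Y"
  obtains Z where "closed Z" "BV r X Y = (X \<rightarrow>\<^sub>E Y) \<inter> Z"
proof
  let ?Z = "{f::'a \<Rightarrow> 'b. \<forall>n x. x ` {1..n::nat} \<subseteq> X \<and> strict_mono_on {1..n} x \<longrightarrow>
        (\<Sum>i = 1..n - 1. dist (f (x i)) (f (x (i + 1)))) \<le> r}"
  show "closed ?Z"
    by (intro closed_Collect_all closed_Collect_imp closed_Collect_le open_Collect_const
        continuous_intros continuous_on_product_coordinates)
  have "bounded (f ` X)" if "f \<in> X \<rightarrow>\<^sub>E Y" for f :: "'a \<Rightarrow> 'b"
    using that compact_imp_bounded[OF assms] by (auto intro: bounded_subset)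
  then show "BV r X Y = (X \<rightarrow>\<^sub>E Y) \<inter> ?Z"
    unfolding BV_def by blast
qed

theorem theorem12p11:
  fixes X :: "'a::linorder set" and Y :: "'b::metric_space set" and r :: real
  assumes "compact Y" and "r > 0"
  shows "compact (BV r X Y) \<and> seq_compact (BV r X Y)"
proof
  obtain Z where Z: "closed Z" "BV r X Y = (X \<rightarrow>\<^sub>E Y) \<inter> Z"
    using BV_eq_Int_closed[OF assms(1)] by blast
  \<comment> \<open>A singleton factor at each point off \<open>X\<close> turns extensionality into
    a product over the whole type, where Tychonoff applies.\<close>
  have "X \<rightarrow>\<^sub>E Y = PiE UNIV (\<lambda>x. if x \<in> X then Y else {undefined})"
    by (auto simp: PiE_iff extensional_def split: if_splits)
  then have "compact (X \<rightarrow>\<^sub>E Y)"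
    using assms(1) by (auto intro!: compact_PiE)
  then show "compact (BV r X Y)"
    using Z by (simp add: compact_Int_closed)
  show "seq_compact (BV r X Y)"
    unfolding seq_compact_def
  proof (intro allI impI)
    fix f :: "nat \<Rightarrow> 'a \<Rightarrow> 'b"
    assume "\<forall>n. f n \<in> BV r X Y"
    then have f: "f n \<in> BV r X Y" and fE: "f n \<in> X \<rightarrow>\<^sub>E Y" and fZ: "f n \<in> Z" for n
      using Z by auto
    have fY: "f n x \<in> Y" if "x \<in> X" for n x using fE that by auto
    obtain s :: "nat \<Rightarrow> nat" where s: "strict_mono s"
      and conv: "\<And>x. x \<in> X \<Longrightarrow> convergent (\<lambda>n. f (s n) x)"
      using Helly_selection_variation[of Y X f "\<lambda>n. variation (f n) X" r]
        assms(1) fY variation_bounds[OF f] variation_add_dist_le[OF f] by blast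
    \<comment> \<open>Off \<open>X\<close> the restriction gives \<open>l\<close> the value
      \<open>undefined\<close>, which all \<open>f n\<close> take there.\<close>
    define l where "l = (\<lambda>x\<in>X. lim (\<lambda>n. f (s n) x))"
    have lim: "(\<lambda>n. f (s n) x) \<longlonglongrightarrow> l x" for x
    proof (cases "x \<in> X")
      case True
      then show ?thesis using conv by (simp add: l_def convergent_LIMSEQ_iff)
    next
      case False
      then have "f n x = undefined" for n using fE PiE_arb by metis
      with False show ?thesis by (simp add: l_def)
    qed
    then have tendsto: "(f \<circ> s) \<longlonglongrightarrow> l"
      by (simp add: tendsto_fun_iff)
    have "l x \<in> Y" if "x \<in> X" for x
      using closed_sequentially[OF compact_imp_closed[OF assms(1)] fY[OF that] lim] .
    then have "l \<in> X \<rightarrow>\<^sub>E Y" by (auto simp: l_def)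
    \<comment> \<open>The variation bound passes to the limit because \<open>Z\<close> is
      closed.\<close>
    moreover have "l \<in> Z"
      by (rule Lim_in_closed_set[OF Z(1) _ _ tendsto]) (auto simp: fZ)
    ultimately show "\<exists>l\<in>BV r X Y. \<exists>s. strict_mono s \<and> (f \<circ> s) \<longlonglongrightarrow> l"
      using s tendsto Z by blast
  qed
qed

end
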